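(* Let $G$ be a finitely generated residually finite group of subexponential growth, and let $X$ be a finite generating set for $G$. Then: (i) $\operatorname{dc}_X(G)>0$ if and only if $G$ is virtually abelian; (ii) $\operatorname{dc}_X(G)>5/8$ if and only if $G$ is abelian.
   Context: Generating sets generate $G$ as a group. For a finite generating set $X$ of $G$, $|g|_X$ is the word length of $g\in G$ with respect to $X\cup X^{-1}$, and $\mathbb{B}_X(n)=\{g\in G : |g|_X\leq n\}$ is the ball of radius $n$ centered at $1$ in the Cayley graph of $G$ with respect to $X$. The degree of commutativity of $G$ with respect to $X$ is $$\operatorname{dc}_X(G)=\limsup_{n\to\infty}\frac{|\{(u,v)\in \mathbb{B}_X(n)^2 : uv=vu\}|}{|\mathbb{B}_X(n)|^2}.$$ $G$ has subexponential growth if $\lim_{n\to\infty}|\mathbb{B}_X(n+1)|/|\mathbb{B}_X(n)|=1$, where $X$ is the given finite generating set. A group is virtually abelian if it has an abelian subgroup of finite index. *)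

theory Defs
  imports "HOL-Algebra.Generated_Groups" "HOL-Library.Extended_Real"
begin

definition generating_set :: "('a, 'b) monoid_scheme \<Rightarrow> 'a set \<Rightarrow> bool" where
  "generating_set G X \<longleftrightarrow> X \<subseteq> carrier G \<and> generate G X = carrier G"

definition word_product :: "('a, 'b) monoid_scheme \<Rightarrow> 'a list \<Rightarrow> 'a" where
  "word_product G ws = foldr (\<otimes>\<^bsub>G\<^esub>) ws \<one>\<^bsub>G\<^esub>"

(* The value is unspecified if g is not a product of elements of X and their inverses;
   it is only used for a generating set X and g in the carrier. *)
definition word_length :: "('a, 'b) monoid_scheme \<Rightarrow> 'a set \<Rightarrow> 'a \<Rightarrow> nat" where
  "word_length G X g =
     (LEAST n. \<exists>ws. set ws \<subseteq> X \<union> set_inv\<^bsub>G\<^esub> X \<and> length ws = n \<and> word_product G ws = g)"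

definition word_ball :: "('a, 'b) monoid_scheme \<Rightarrow> 'a set \<Rightarrow> nat \<Rightarrow> 'a set" where
  "word_ball G X n = {g \<in> carrier G. word_length G X g \<le> n}"

definition commuting_pairs :: "('a, 'b) monoid_scheme \<Rightarrow> 'a set \<Rightarrow> ('a \<times> 'a) set" where
  "commuting_pairs G B = {(u, v). u \<in> B \<and> v \<in> B \<and> u \<otimes>\<^bsub>G\<^esub> v = v \<otimes>\<^bsub>G\<^esub> u}"

(* The limsup is taken in ereal, where it always exists; the ratios lie in [0,1]. *)
definition dc :: "('a, 'b) monoid_scheme \<Rightarrow> 'a set \<Rightarrow> ereal" where
  "dc G X = limsup (\<lambda>n. ereal
     (real (card (commuting_pairs G (word_ball G X n))) / (real (card (word_ball G X n)))\<^sup>2))"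

definition subexponential_growth :: "('a, 'b) monoid_scheme \<Rightarrow> 'a set \<Rightarrow> bool" where
  "subexponential_growth G X \<longleftrightarrow>
     (\<lambda>n. real (card (word_ball G X (n + 1))) / real (card (word_ball G X n))) \<longlonglongrightarrow> 1"

definition finite_index :: "('a, 'b) monoid_scheme \<Rightarrow> 'a set \<Rightarrow> bool" where
  "finite_index G H \<longleftrightarrow> finite (rcosets\<^bsub>G\<^esub> H)"

definition residually_finite :: "('a, 'b) monoid_scheme \<Rightarrow> bool" where
  "residually_finite G \<longleftrightarrow>
     (\<forall>g \<in> carrier G. g \<noteq> \<one>\<^bsub>G\<^esub> \<longrightarrow> (\<exists>N. N \<lhd> G \<and> finite_index G N \<and> g \<notin> N))"

definition virtually_abelian :: "('a, 'b) monoid_scheme \<Rightarrow> bool" where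
  "virtually_abelian G \<longleftrightarrow>
     (\<exists>H. subgroup H G \<and> finite_index G H \<and> comm_group (G\<lparr>carrier := H\<rparr>))"

end

theory Submission
  imports Defs
begin

text \<open>In a group of subexponential growth every coset of a finite-index normal subgroup \<open>N\<close>
  occupies asymptotically the same proportion of the balls, so \<open>dc G X\<close> is at most the commuting
  probability of the finite group \<open>G / N\<close>. A non-abelian finite group has commuting probability
  at most \<open>5/8\<close>, and by Gallagher's inequality commuting probabilities are submultiplicative
  under extensions. If \<open>G\<close> is residually finite but not virtually abelian, one descends through
  finite-index normal subgroups with non-abelian successive quotients, which forces \<open>dc G X\<close> below every
  power of \<open>5/8\<close>.\<close>

section \<open>Commuting pairs in finite groups\<close>


text \<open>A set argument covers both uses: \<open>A = {x}\<close> gives the centralizer of an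
  element, \<open>A = carrier G\<close> the centre.\<close>

definition centralizer :: "('a, 'b) monoid_scheme \<Rightarrow> 'a set \<Rightarrow> 'a set" where
  "centralizer G A = {y \<in> carrier G. \<forall>a\<in>A. a \<otimes>\<^bsub>G\<^esub> y = y \<otimes>\<^bsub>G\<^esub> a}"

lemma (in group) subgroup_centralizer:
  assumes "A \<subseteq> carrier G"
  shows "subgroup (centralizer G A) G"
proof
  fix x y assume x: "x \<in> centralizer G A" and y: "y \<in> centralizer G A"
  show "x \<otimes> y \<in> centralizer G A"
    using x y assms unfolding centralizer_def
    by (auto simp: subset_iff) (metis m_assoc)
next
  fix x assume x: "x \<in> centralizer G A"
  have "a \<otimes> inv x = inv x \<otimes> a" if "a \<in> A" for a
  proof -
    have "x \<in> carrier G" "a \<in> carrier G" "a \<otimes> x = x \<otimes> a"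
      using x assms that by (auto simp: centralizer_def)
    thus ?thesis by (metis inv_closed inv_solve_left inv_solve_right m_assoc m_closed)
  qed
  thus "inv x \<in> centralizer G A" using x by (auto simp: centralizer_def)
qed (use assms in \<open>auto simp: centralizer_def subset_iff\<close>)

text \<open>For \<open>x\<close> in \<open>K\<close> but not in \<open>H\<close>, the coset
  \<open>H #> x\<close> is a second copy of \<open>H\<close> inside \<open>K\<close>, disjoint from
  the first.\<close>

lemma (in group) card_proper_subgroup_le_half:
  assumes H: "subgroup H G" and K: "subgroup K G" and "finite K" and HK: "H \<subset> K"
  shows "2 * card H \<le> card K"
proof -
  obtain x where x: "x \<in> K" "x \<notin> H" using HK by blast
  have xG: "x \<in> carrier G" using x K subgroup.subset by blast
  have "H #> x \<in> rcosets H" using xG H by (simp add: rcosetsI subgroup.subset)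
  hence card: "card (H #> x) = card H"
    using card_rcosets_equal[OF _ subgroup.subset[OF H]] by auto
  have sub: "H #> x \<subseteq> K"
    using x HK subgroup.m_closed[OF K] unfolding r_coset_def by blast
  have "H \<inter> (H #> x) = {}"
  proof -
    have "False" if "h \<in> H" "h \<otimes> x \<in> H" for h
    proof -
      have "x = inv h \<otimes> (h \<otimes> x)"
        using that xG subgroup.mem_carrier[OF H] by (simp add: inv_solve_left)
      thus False using x that H by (metis subgroup.m_closed subgroup.m_inv_closed)
    qed
    thus ?thesis unfolding r_coset_def by blast
  qed
  hence "card (H \<union> (H #> x)) = 2 * card H"
    using card sub HK \<open>finite K\<close> by (subst card_Un_disjoint) (auto intro: finite_subset)
  moreover have "card (H \<union> (H #> x)) \<le> card K"
    using sub HK \<open>finite K\<close> by (intro card_mono) auto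
  ultimately show ?thesis by simp
qed

lemma finite_commuting_pairs: "finite B \<Longrightarrow> finite (commuting_pairs G B)"
  by (rule finite_subset[of _ "B \<times> B"]) (auto simp: commuting_pairs_def)

lemma card_commuting_pairs_le: "finite B \<Longrightarrow> card (commuting_pairs G B) \<le> (card B)\<^sup>2"
  unfolding power2_eq_square card_cartesian_product[symmetric]
  by (intro card_mono) (auto simp: commuting_pairs_def)

lemma card_commuting_pairs:
  assumes "finite B"
  shows "card (commuting_pairs G B) = (\<Sum>x\<in>B. card {y \<in> B. x \<otimes>\<^bsub>G\<^esub> y = y \<otimes>\<^bsub>G\<^esub> x})"
proof -
  have "commuting_pairs G B = (SIGMA x:B. {y \<in> B. x \<otimes>\<^bsub>G\<^esub> y = y \<otimes>\<^bsub>G\<^esub> x})"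
    by (auto simp: commuting_pairs_def)
  thus ?thesis using assms by (simp add: card_SigmaI)
qed

text \<open>Pairs are counted by their first entry. With \<open>n\<close> the order of the group, a
  central element contributes \<open>n\<close>, any other at most \<open>n / 2\<close> because its
  centralizer is a proper subgroup. The centre lies properly in the centralizer of \<open>a\<close>,
  which lies properly in \<open>G\<close>, so the centre has at most \<open>n / 4\<close> elements,
  and the total is at most \<open>n * (n + n / 4) / 2\<close>.\<close>

lemma (in group) card_commuting_pairs_carrier_nonabelian:
  assumes fin: "finite (carrier G)"
    and ab: "a \<in> carrier G" "b \<in> carrier G" "a \<otimes> b \<noteq> b \<otimes> a"
  shows "8 * card (commuting_pairs G (carrier G)) \<le> 5 * (card (carrier G))\<^sup>2"
proof -
  let ?Z = "centralizer G (carrier G)" and ?n = "card (carrier G)"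
  have Z: "subgroup ?Z G" and C: "x \<in> carrier G \<Longrightarrow> subgroup (centralizer G {x}) G" for x
    by (simp_all add: subgroup_centralizer)
  have half: "2 * card (centralizer G {x}) \<le> ?n" if x: "x \<in> carrier G" "x \<notin> ?Z" for x
  proof (intro card_proper_subgroup_le_half C subgroup_self)
    obtain y where "y \<in> carrier G" "y \<otimes> x \<noteq> x \<otimes> y"
      using x by (auto simp: centralizer_def)
    hence "y \<in> carrier G - centralizer G {x}" by (auto simp: centralizer_def)
    thus "centralizer G {x} \<subset> carrier G" by (auto simp: centralizer_def)
  qed (use x fin in auto)
  have "2 * card ?Z \<le> card (centralizer G {a})"
  proof (intro card_proper_subgroup_le_half C Z)
    show "finite (centralizer G {a})" using fin by (simp add: centralizer_def)
    have "a \<in> centralizer G {a}" "a \<notin> ?Z" using ab by (simp_all add: centralizer_def) metis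
    thus "?Z \<subset> centralizer G {a}" using ab by (auto simp: centralizer_def)
  qed (use ab in auto)
  moreover have "a \<notin> ?Z" using ab by (simp add: centralizer_def) metis
  ultimately have Z4: "4 * card ?Z \<le> ?n" using half[of a] ab by linarith
  have ZG: "?Z \<subseteq> carrier G" by (auto simp: centralizer_def)
  \<comment> \<open>The count is doubled so that the bounds by halves stay within the natural
    numbers.\<close>
  have "2 * card (commuting_pairs G (carrier G)) = (\<Sum>x\<in>carrier G. 2 * card (centralizer G {x}))"
    by (simp add: card_commuting_pairs[OF fin] centralizer_def sum_distrib_left)
  also have "\<dots> = (\<Sum>x\<in>?Z. 2 * card (centralizer G {x}))
      + (\<Sum>x\<in>carrier G - ?Z. 2 * card (centralizer G {x}))"
    using sum.subset_diff[OF ZG fin] by (simp add: add.commute)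
  also have "\<dots> \<le> (\<Sum>x\<in>?Z. 2 * ?n) + (\<Sum>x\<in>carrier G - ?Z. ?n)"
    using half fin ZG
    by (intro add_mono sum_mono) (auto intro!: card_mono simp: centralizer_def)
  also have "\<dots> = card ?Z * (2 * ?n) + (?n - card ?Z) * ?n"
    using fin ZG by (simp add: card_Diff_subset finite_subset)
  \<comment> \<open>\<open>Z4\<close> implies \<open>card ?Z \<le> ?n\<close>, so nothing is lost to
    truncated subtraction.\<close>
  also have "\<dots> = (?n + card ?Z) * ?n"
    using Z4 by (simp add: algebra_simps diff_mult_distrib)
  finally have "8 * card (commuting_pairs G (carrier G)) \<le> (4 * ?n + 4 * card ?Z) * ?n"
    by (simp add: algebra_simps)
  also have "\<dots> \<le> (5 * ?n) * ?n" using Z4 by (intro mult_right_mono) auto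
  finally show ?thesis by (simp add: power2_eq_square)
qed

lemma (in group) card_commuting_pairs_nonabelian:
  assumes H: "subgroup H G" and fin: "finite H" and ab: "a \<in> H" "b \<in> H" "a \<otimes> b \<noteq> b \<otimes> a"
  shows "8 * card (commuting_pairs G H) \<le> 5 * (card H)\<^sup>2"
proof -
  interpret H: group "G\<lparr>carrier := H\<rparr>" using H by (rule subgroup_imp_group)
  show ?thesis
    using H.card_commuting_pairs_carrier_nonabelian[of a b] fin ab by (simp add: commuting_pairs_def)
qed

text \<open>A fibre of \<open>h\<close> meets the centralizer of \<open>x\<close> either not at all
  or in a coset of the part of the kernel that commutes with \<open>x\<close>: dividing by one fixed
  element \<open>z\<close> of the intersection moves it into the kernel.\<close>

lemma (in group_hom) card_commuting_in_fiber_le: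
  assumes fin: "finite (carrier G)" and x: "x \<in> carrier G"
  shows "card {y \<in> carrier G. h y = q \<and> x \<otimes> y = y \<otimes> x}
    \<le> card {y \<in> kernel G H h. x \<otimes> y = y \<otimes> x}"
proof (cases "{y \<in> carrier G. h y = q \<and> x \<otimes> y = y \<otimes> x} = {}")
  case False
  then obtain z where z: "z \<in> carrier G" "h z = q" "x \<otimes> z = z \<otimes> x" by blast
  have zC: "z \<in> centralizer G {x}" using z by (simp add: centralizer_def)
  have C: "subgroup (centralizer G {x}) G" using x by (simp add: G.subgroup_centralizer)
  show ?thesis
  proof (rule card_inj_on_le[where f = "\<lambda>y. y \<otimes> inv z"])
    show "inj_on (\<lambda>y. y \<otimes> inv z) {y \<in> carrier G. h y = q \<and> x \<otimes> y = y \<otimes> x}"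
      using z by (auto intro!: inj_onI)
    show "(\<lambda>y. y \<otimes> inv z) ` {y \<in> carrier G. h y = q \<and> x \<otimes> y = y \<otimes> x}
      \<subseteq> {y \<in> kernel G H h. x \<otimes> y = y \<otimes> x}"
    proof clarify
      fix y assume y: "y \<in> carrier G" "q = h y" "x \<otimes> y = y \<otimes> x"
      have "y \<in> centralizer G {x}" using y by (simp add: centralizer_def)
      hence "y \<otimes> inv z \<in> centralizer G {x}"
        using zC C by (simp add: subgroup.m_closed subgroup.m_inv_closed)
      thus "y \<otimes> inv z \<in> kernel G H h \<and> x \<otimes> (y \<otimes> inv z) = y \<otimes> inv z \<otimes> x"
        using y z by (simp add: centralizer_def kernel_def)
    qed
    show "finite {y \<in> kernel G H h. x \<otimes> y = y \<otimes> x}"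
      using fin by (simp add: kernel_def)
  qed
qed (metis card.empty le0)

text \<open>Gallagher's inequality.\<close>

lemma (in group_hom) card_commuting_pairs_le_kernel:
  assumes fin: "finite (carrier G)" and finH: "finite (carrier H)"
  shows "card (commuting_pairs G (carrier G))
    \<le> card (commuting_pairs H (carrier H)) * card (commuting_pairs G (kernel G H h))"
proof -
  let ?K = "kernel G H h"
  let ?CK = "\<lambda>x. card {y \<in> ?K. x \<otimes> y = y \<otimes> x}"
  let ?CH = "\<lambda>q. {r \<in> carrier H. q \<otimes>\<^bsub>H\<^esub> r = r \<otimes>\<^bsub>H\<^esub> q}"
  have finK: "finite ?K" using fin by (simp add: kernel_def)
  have KG: "?K \<subseteq> carrier G" by (auto simp: kernel_def)
  \<comment> \<open>Whatever commutes with \<open>x\<close> has an image commuting with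
    \<open>h x\<close>. The elements are sorted by this image, and each fibre contributes at most
    \<open>?CK x\<close>.\<close>
  have 1: "card {y \<in> carrier G. x \<otimes> y = y \<otimes> x} \<le> card (?CH (h x)) * ?CK x"
    if x: "x \<in> carrier G" for x
  proof -
    have "{y \<in> carrier G. x \<otimes> y = y \<otimes> x}
        \<subseteq> (\<Union>r\<in>?CH (h x). {y \<in> carrier G. h y = r \<and> x \<otimes> y = y \<otimes> x})"
      using x by auto (metis hom_mult)
    hence "card {y \<in> carrier G. x \<otimes> y = y \<otimes> x}
        \<le> card (\<Union>r\<in>?CH (h x). {y \<in> carrier G. h y = r \<and> x \<otimes> y = y \<otimes> x})"
      using fin finH by (intro card_mono) auto
    also have "\<dots> \<le> (\<Sum>r\<in>?CH (h x). card {y \<in> carrier G. h y = r \<and> x \<otimes> y = y \<otimes> x})"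
      using finH by (intro card_UN_le) auto
    also have "\<dots> \<le> (\<Sum>r\<in>?CH (h x). ?CK x)"
      using fin x by (intro sum_mono card_commuting_in_fiber_le)
    finally show ?thesis by simp
  qed
  \<comment> \<open>Double counting of the commuting pairs with first entry in the fibre over
    \<open>q\<close> and second entry in the kernel. After the swap, the fibre bound is used a
    second time, now with the kernel element \<open>y\<close> as the fixed one.\<close>
  have 2: "(\<Sum>x\<in>{x \<in> carrier G. h x = q}. ?CK x) \<le> card (commuting_pairs G ?K)" for q
  proof -
    have "(\<Sum>x\<in>{x \<in> carrier G. h x = q}. ?CK x)
        = (\<Sum>x\<in>{x \<in> carrier G. h x = q}. \<Sum>y | y \<in> ?K \<and> x \<otimes> y = y \<otimes> x. 1)" by simp
    also have "\<dots> = (\<Sum>y\<in>?K. \<Sum>x | x \<in> {x \<in> carrier G. h x = q} \<and> x \<otimes> y = y \<otimes> x. 1)"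
      using fin finK by (intro sum.swap_restrict) auto
    also have "\<dots> = (\<Sum>y\<in>?K. card {x \<in> carrier G. h x = q \<and> y \<otimes> x = x \<otimes> y})"
      by (intro sum.cong) (auto intro!: arg_cong[of _ _ card])
    also have "\<dots> \<le> (\<Sum>y\<in>?K. ?CK y)"
      using fin KG by (intro sum_mono card_commuting_in_fiber_le) auto
    finally show ?thesis by (simp add: card_commuting_pairs[OF finK])
  qed
  have "card (commuting_pairs G (carrier G)) \<le> (\<Sum>x\<in>carrier G. card (?CH (h x)) * ?CK x)"
    unfolding card_commuting_pairs[OF fin] using 1 by (rule sum_mono)
  \<comment> \<open>Grouping by \<open>q = h x\<close> makes the first factor constant on each
    group, so that it can be pulled out and \<open>2\<close> applied to what remains.\<close>
  also have "\<dots> = (\<Sum>q\<in>carrier H. \<Sum>x\<in>{x \<in> carrier G. h x = q}. card (?CH (h x)) * ?CK x)"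
    using fin finH by (subst sum.group) auto
  also have "\<dots> = (\<Sum>q\<in>carrier H. card (?CH q) * (\<Sum>x\<in>{x \<in> carrier G. h x = q}. ?CK x))"
    by (simp add: sum_distrib_left)
  also have "\<dots> \<le> (\<Sum>q\<in>carrier H. card (?CH q) * card (commuting_pairs G ?K))"
    using 2 by (intro sum_mono mult_left_mono) auto
  finally show ?thesis by (simp add: card_commuting_pairs[OF finH] sum_distrib_right)
qed

text \<open>The set is a separate argument so that a kernel can be treated inside its ambient group.
  If \<open>B\<close> is empty or infinite, the denominator is zero and the value is 0.\<close>

definition commuting_probability :: "('a, 'b) monoid_scheme \<Rightarrow> 'a set \<Rightarrow> real" where
  "commuting_probability G B = real (card (commuting_pairs G B)) / (real (card B))\<^sup>2"

lemma commuting_probability_nonneg: "0 \<le> commuting_probability G B"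
  by (simp add: commuting_probability_def)

lemma commuting_probability_le_1: "finite B \<Longrightarrow> commuting_probability G B \<le> 1"
  using card_commuting_pairs_le[of B G]
  by (auto simp: commuting_probability_def divide_le_eq simp flip: of_nat_power)

text \<open>By Lagrange and the first isomorphism theorem the order of \<open>G\<close> is that of
  \<open>H\<close> times that of the kernel; Gallagher's inequality is divided by its
  square.\<close>

lemma (in group_hom) commuting_probability_le_kernel:
  assumes fin: "finite (carrier G)" and surj: "h ` carrier G = carrier H"
  shows "commuting_probability G (carrier G)
    \<le> commuting_probability H (carrier H) * commuting_probability G (kernel G H h)"
proof -
  have finH: "finite (carrier H)" using fin surj by (metis finite_imageI)
  have "card (carrier G) = card (carrier H) * card (kernel G H h)"
    using iso_same_card[OF FactGroup_iso[OF surj]] G.lagrange[OF subgroup_kernel]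
    by (simp add: FactGroup_def order_def)
  moreover have "real (card (commuting_pairs G (carrier G)))
    \<le> real (card (commuting_pairs H (carrier H))) * real (card (commuting_pairs G (kernel G H h)))"
    using card_commuting_pairs_le_kernel[OF fin finH] by (simp flip: of_nat_mult)
  ultimately show ?thesis
    by (simp add: commuting_probability_def power_mult_distrib divide_right_mono)
qed

lemma (in group) commuting_probability_nonabelian:
  assumes "subgroup H G" "finite H" "a \<in> H" "b \<in> H" "a \<otimes> b \<noteq> b \<otimes> a"
  shows "commuting_probability G H \<le> 5 / 8"
proof -
  have "real (8 * card (commuting_pairs G H)) \<le> real (5 * (card H)\<^sup>2)"
    using card_commuting_pairs_nonabelian[OF assms] by (simp only: of_nat_le_iff)
  moreover have "card H > 0" using assms by (auto simp: card_gt_0_iff)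
  ultimately show ?thesis by (simp add: commuting_probability_def field_simps)
qed

section \<open>Balls in groups of subexponential growth\<close>


lemma (in group) word_product_closed:
  "set ws \<subseteq> carrier G \<Longrightarrow> word_product G ws \<in> carrier G"
  by (induction ws) (auto simp: word_product_def)

lemma (in group) word_product_append:
  "set us \<subseteq> carrier G \<Longrightarrow> set vs \<subseteq> carrier G \<Longrightarrow>
    word_product G (us @ vs) = word_product G us \<otimes> word_product G vs"
proof (induction us)
  case Nil
  thus ?case using word_product_closed[of vs] by (simp add: word_product_def)
next
  case (Cons a us)
  have "word_product G (a # us @ vs) = a \<otimes> word_product G (us @ vs)"
    "word_product G (a # us) = a \<otimes> word_product G us"
    by (simp_all add: word_product_def)
  thus ?case
    using Cons word_product_closed[of us] word_product_closed[of vs] by (simp add: m_assoc)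
qed

locale finitely_generated_group = group +
  fixes X
  assumes finite_generators: "finite X" and generators: "generating_set G X"
begin

abbreviation ball :: "nat \<Rightarrow> 'a set" where "ball \<equiv> word_ball G X"

lemma letters_subset: "X \<union> set_inv X \<subseteq> carrier G"
  using generators by (auto simp: generating_set_def SET_INV_def)

text \<open>Ensures that the \<open>LEAST\<close> in \<open>word_length\<close> is attained for
  every element of the carrier.\<close>

lemma ex_word:
  assumes "g \<in> carrier G"
  shows "\<exists>ws. set ws \<subseteq> X \<union> set_inv X \<and> word_product G ws = g"
proof -
  have "g \<in> generate G X" using assms generators by (simp add: generating_set_def)
  thus ?thesis
  proof induction
    case one
    show ?case by (rule exI[of _ "[]"]) (simp add: word_product_def)
  next
    case (incl h)
    thus ?case using letters_subset by (intro exI[of _ "[h]"]) (auto simp: word_product_def)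
  next
    case (inv h)
    hence "inv h \<in> set_inv X" by (auto simp: SET_INV_def)
    thus ?case using letters_subset by (intro exI[of _ "[inv h]"]) (auto simp: word_product_def)
  next
    case (eng h1 h2)
    then obtain us vs where "set us \<subseteq> X \<union> set_inv X" "word_product G us = h1"
      "set vs \<subseteq> X \<union> set_inv X" "word_product G vs = h2" by blast
    moreover from this have "set us \<subseteq> carrier G" "set vs \<subseteq> carrier G"
      using letters_subset by blast+
    ultimately show ?case
      by (intro exI[of _ "us @ vs"]) (simp add: word_product_append)
  qed
qed

text \<open>Trades the minimal length for the existence of some short word, which is what finiteness
  of balls and the bound for products rest on.\<close>

lemma mem_ball_iff:
  "g \<in> ball n \<longleftrightarrow> (\<exists>ws. set ws \<subseteq> X \<union> set_inv X \<and> length ws \<le> n \<and> word_product G ws = g)"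
    (is "_ \<longleftrightarrow> ?R")
proof
  assume g: "g \<in> ball n"
  let ?P = "\<lambda>l. \<exists>ws. set ws \<subseteq> X \<union> set_inv X \<and> length ws = l \<and> word_product G ws = g"
  have "\<exists>l. ?P l" using ex_word g by (auto simp: word_ball_def)
  hence "?P (word_length G X g)" unfolding word_length_def by (rule LeastI_ex)
  thus ?R using g by (auto simp: word_ball_def)
next
  assume ?R
  then obtain ws where ws: "set ws \<subseteq> X \<union> set_inv X" "length ws \<le> n" "word_product G ws = g"
    by blast
  have "word_length G X g \<le> length ws"
    unfolding word_length_def using ws by (intro Least_le) blast
  moreover have "g \<in> carrier G" using ws letters_subset word_product_closed by blast
  ultimately show "g \<in> ball n" using ws by (simp add: word_ball_def)
qed

lemma ball_subset: "ball n \<subseteq> carrier G"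
  by (auto simp: word_ball_def)

lemma finite_ball: "finite (ball n)"
proof (rule finite_subset)
  show "ball n \<subseteq> word_product G ` {ws. set ws \<subseteq> X \<union> set_inv X \<and> length ws \<le> n}"
    by (auto simp: mem_ball_iff)
  have "finite (X \<union> set_inv X)" using finite_generators by (simp add: SET_INV_def)
  thus "finite (word_product G ` {ws. set ws \<subseteq> X \<union> set_inv X \<and> length ws \<le> n})"
    by (intro finite_imageI finite_lists_length_le)
qed

lemma card_ball_pos: "card (ball n) > 0"
proof -
  have "\<one> \<in> ball n" unfolding mem_ball_iff by (rule exI[of _ "[]"]) (simp add: word_product_def)
  thus ?thesis using finite_ball card_gt_0_iff by blast
qed

lemma mult_mem_ball: "x \<in> ball m \<Longrightarrow> y \<in> ball n \<Longrightarrow> x \<otimes> y \<in> ball (m + n)"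
proof -
  assume "x \<in> ball m" "y \<in> ball n"
  then obtain us vs where "set us \<subseteq> X \<union> set_inv X" "word_product G us = x" "length us \<le> m"
      "set vs \<subseteq> X \<union> set_inv X" "word_product G vs = y" "length vs \<le> n"
    unfolding mem_ball_iff by blast
  moreover from this have "set us \<subseteq> carrier G" "set vs \<subseteq> carrier G"
    using letters_subset by blast+
  ultimately show ?thesis
    unfolding mem_ball_iff by (intro exI[of _ "us @ vs"]) (simp add: word_product_append)
qed

section \<open>Distribution of balls over the cosets of a finite-index subgroup\<close>

lemma ball_mono: "m \<le> n \<Longrightarrow> ball m \<subseteq> ball n"
  by (auto simp: word_ball_def)

text \<open>Right translation by a fixed element moves one coset into another and increases the
  word length by a bounded amount, so all cosets have nearly the same share of a ball.\<close>

lemma card_coset_ball_shift: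
  assumes H: "subgroup H G" and fin: "finite_index G H"
  obtains k where "\<And>A B n. A \<in> rcosets H \<Longrightarrow> B \<in> rcosets H \<Longrightarrow>
    card (A \<inter> ball n) \<le> card (B \<inter> ball (n + k))"
proof -
  have "\<exists>l. \<forall>n. card (A \<inter> ball n) \<le> card (B \<inter> ball (n + l))"
    if AB: "A \<in> rcosets H" "B \<in> rcosets H" for A B
  proof -
    obtain a b where a: "a \<in> carrier G" "A = H #> a" and b: "b \<in> carrier G" "B = H #> b"
      using AB unfolding RCOSETS_def by blast
    \<comment> \<open>Right multiplication by \<open>?t\<close> sends \<open>h \<otimes> a\<close>
      to \<open>h \<otimes> b\<close>, and the length of \<open>?t\<close> bounds the growth in
      length.\<close>
    let ?t = "inv a \<otimes> b"
    have t: "?t \<in> carrier G" using a b by simp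
    then obtain l where l: "?t \<in> ball l" unfolding word_ball_def by blast
    have "card (A \<inter> ball n) \<le> card (B \<inter> ball (n + l))" for n
    proof (rule card_inj_on_le[where f = "\<lambda>x. x \<otimes> ?t"])
      show "inj_on (\<lambda>x. x \<otimes> ?t) (A \<inter> ball n)"
        using t ball_subset by (auto intro!: inj_onI simp: subset_iff)
      show "(\<lambda>x. x \<otimes> ?t) ` (A \<inter> ball n) \<subseteq> B \<inter> ball (n + l)"
      proof clarify
        fix x assume x: "x \<in> A" "x \<in> ball n"
        then obtain h where h: "h \<in> H" "x = h \<otimes> a" using a unfolding r_coset_def by blast
        have "h \<in> carrier G" by (rule subgroup.mem_carrier[OF H h(1)])
        moreover have "a \<otimes> ?t = b" using a(1) b(1) m_assoc[of a "inv a" b] by simp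
        ultimately have "x \<otimes> ?t = h \<otimes> b"
          unfolding h(2) using a(1) t m_assoc[of h a ?t] by simp
        hence "x \<otimes> ?t \<in> B" using h b unfolding r_coset_def by blast
        thus "x \<otimes> ?t \<in> B \<inter> ball (n + l)" using mult_mem_ball[OF x(2) l] by simp
      qed
    qed (simp add: finite_ball)
    thus ?thesis by blast
  qed
  then obtain l where l: "\<And>A B n. A \<in> rcosets H \<Longrightarrow> B \<in> rcosets H \<Longrightarrow>
    card (A \<inter> ball n) \<le> card (B \<inter> ball (n + l A B))" by metis
  \<comment> \<open>Finite index leaves finitely many pairs of cosets, so one shift serves them
    all.\<close>
  define k where "k = Max ((\<lambda>(A, B). l A B) ` ((rcosets H) \<times> (rcosets H)))"
  have "card (A \<inter> ball n) \<le> card (B \<inter> ball (n + k))"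
    if AB: "A \<in> rcosets H" "B \<in> rcosets H" for A B n
  proof -
    have "l A B \<le> k"
      unfolding k_def using AB fin by (intro Max_ge) (auto simp: finite_index_def)
    hence "B \<inter> ball (n + l A B) \<subseteq> B \<inter> ball (n + k)"
      using ball_mono[of "n + l A B" "n + k"] by auto
    hence "card (B \<inter> ball (n + l A B)) \<le> card (B \<inter> ball (n + k))"
      using finite_ball by (intro card_mono) auto
    thus ?thesis using l[OF AB, of n] by linarith
  qed
  thus ?thesis using that by blast
qed

text \<open>A ball is the disjoint union of its parts in the cosets. Summing the shift inequality
  over the target coset gives the first bound, over the source coset the second.\<close>

lemma card_coset_ball_bounds:
  assumes H: "subgroup H G" and fin: "finite_index G H"
  obtains k where
    "\<And>A n. A \<in> rcosets H \<Longrightarrow> card (rcosets H) * card (A \<inter> ball n) \<le> card (ball (n + k))"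
    "\<And>A n. A \<in> rcosets H \<Longrightarrow> card (ball n) \<le> card (rcosets H) * card (A \<inter> ball (n + k))"
proof -
  obtain k where k: "\<And>A B n. A \<in> rcosets H \<Longrightarrow> B \<in> rcosets H \<Longrightarrow>
    card (A \<inter> ball n) \<le> card (B \<inter> ball (n + k))"
    using card_coset_ball_shift[OF assms] by blast
  have split: "card (ball n) = (\<Sum>A\<in>rcosets H. card (A \<inter> ball n))" for n
  proof -
    have "ball n = (\<Union>A\<in>rcosets H. A \<inter> ball n)"
      using rcosets_part_G[OF H] ball_subset by blast
    also have "card \<dots> = (\<Sum>A\<in>rcosets H. card (A \<inter> ball n))"
      using fin finite_ball rcos_disjoint[OF H]
      by (intro card_UN_disjoint) (auto simp: finite_index_def pairwise_def disjnt_def)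
    finally show ?thesis .
  qed
  show ?thesis
  proof (rule that)
    fix A n assume A: "A \<in> rcosets H"
    show "card (rcosets H) * card (A \<inter> ball n) \<le> card (ball (n + k))"
      unfolding split[of "n + k"] using A k by (intro sum_bounded_below[where 'a=nat, simplified])
    show "card (ball n) \<le> card (rcosets H) * card (A \<inter> ball (n + k))"
      unfolding split[of n] using A k by (intro sum_bounded_above[where 'a=nat, simplified])
  qed
qed

section \<open>Growth and bounds for the degree of commutativity\<close>

lemma index_pos:
  assumes "finite_index G H"
  shows "card (rcosets H) > 0"
  using assms one_closed unfolding finite_index_def RCOSETS_def by (auto simp: card_gt_0_iff)

text \<open>The quotient telescopes into \<open>k\<close> ratios of consecutive balls, each tending
  to 1.\<close>

lemma ball_ratio_tendsto:
  assumes "subexponential_growth G X"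
  shows "(\<lambda>n. real (card (ball (n + k))) / real (card (ball n))) \<longlonglongrightarrow> 1"
proof (induction k)
  case 0
  have "real (card (ball (n + 0))) / real (card (ball n)) = 1" for n
    using card_ball_pos[of n] by simp
  thus ?case by (simp only: tendsto_const)
next
  case (Suc k)
  have "(\<lambda>n. real (card (ball (n + k + 1))) / real (card (ball (n + k)))) \<longlonglongrightarrow> 1"
    using assms[unfolded subexponential_growth_def, THEN LIMSEQ_ignore_initial_segment, of k] .
  from tendsto_mult[OF this Suc] show ?case
    using card_ball_pos by (simp add: field_simps less_imp_neq[symmetric])
qed

text \<open>Each coset holds at most a share \<open>1 / m\<close> of the ball of radius
  \<open>n + k\<close>. Passing from this radius back to \<open>n\<close> costs only the square of a
  ball ratio, which tends to 1 and so disappears in the limit.\<close>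

lemma dc_le_commuting_probability:
  assumes sub: "subexponential_growth G X" and N: "N \<lhd> G" and fin: "finite_index G N"
  shows "dc G X \<le> ereal (commuting_probability (G Mod N) (carrier (G Mod N)))"
proof -
  interpret N: normal N G by fact
  define m where "m = card (rcosets N)"
  define P where "P = commuting_pairs (G Mod N) (rcosets N)"
  have finR: "finite (rcosets N)" using fin by (simp add: finite_index_def)
  have finP: "finite P" unfolding P_def using finR by (rule finite_commuting_pairs)
  have m: "m > 0" unfolding m_def by (rule index_pos[OF fin])
  obtain k where k: "\<And>A n. A \<in> rcosets N \<Longrightarrow> m * card (A \<inter> ball n) \<le> card (ball (n + k))"
    using card_coset_ball_bounds[OF N.subgroup_axioms fin] unfolding m_def by metis
  have le: "m\<^sup>2 * card (commuting_pairs G (ball n)) \<le> card P * (card (ball (n + k)))\<^sup>2" for n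
  proof -
    \<comment> \<open>Commuting elements lie in commuting cosets, so every pair falls into a product
      of two cosets indexed by \<open>P\<close>.\<close>
    have "commuting_pairs G (ball n) \<subseteq> (\<Union>(A, B)\<in>P. (A \<inter> ball n) \<times> (B \<inter> ball n))"
    proof (rule subrelI)
      fix u v assume uv: "(u, v) \<in> commuting_pairs G (ball n)"
      hence c: "u \<in> carrier G" "v \<in> carrier G"
        using ball_subset by (auto simp: commuting_pairs_def)
      hence "(N #> u, N #> v) \<in> P"
        using uv by (simp add: P_def commuting_pairs_def N.rcos_sum rcosetsI N.subset)
      thus "(u, v) \<in> (\<Union>(A, B)\<in>P. (A \<inter> ball n) \<times> (B \<inter> ball n))"
        using uv rcos_self[OF c(1) N.subgroup_axioms] rcos_self[OF c(2) N.subgroup_axioms]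
        by (intro UN_I[of "(N #> u, N #> v)"]) (auto simp: commuting_pairs_def)
    qed
    hence "card (commuting_pairs G (ball n))
        \<le> card (\<Union>(A, B)\<in>P. (A \<inter> ball n) \<times> (B \<inter> ball n))"
      using finP finite_ball by (intro card_mono) auto
    also have "\<dots> \<le> (\<Sum>(A, B)\<in>P. card ((A \<inter> ball n) \<times> (B \<inter> ball n)))"
      using card_UN_le[OF finP] by (simp add: case_prod_unfold)
    finally have "m\<^sup>2 * card (commuting_pairs G (ball n))
        \<le> m\<^sup>2 * (\<Sum>(A, B)\<in>P. card (A \<inter> ball n) * card (B \<inter> ball n))"
      by (simp add: card_cartesian_product)
    \<comment> \<open>One factor \<open>m\<close> goes to each of the two cosets, matching the form
      of the bound \<open>k\<close>.\<close>
    also have "\<dots> = (\<Sum>(A, B)\<in>P. (m * card (A \<inter> ball n)) * (m * card (B \<inter> ball n)))"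
      by (simp add: sum_distrib_left power2_eq_square case_prod_unfold mult_ac)
    also have "\<dots> \<le> (\<Sum>(A, B)\<in>P. card (ball (n + k)) * card (ball (n + k)))"
      by (intro sum_mono) (auto simp: P_def commuting_pairs_def intro!: mult_le_mono k)
    finally show ?thesis by (simp add: power2_eq_square)
  qed
  let ?r = "\<lambda>n. real (card (ball (n + k))) / real (card (ball n))"
  define c where "c = commuting_probability (G Mod N) (carrier (G Mod N))"
  have c: "c = real (card P) / (real m)\<^sup>2"
    by (simp add: c_def commuting_probability_def P_def m_def FactGroup_def)
  have "(\<lambda>n. c * (?r n)\<^sup>2) \<longlonglongrightarrow> c * 1\<^sup>2"
    by (intro tendsto_intros ball_ratio_tendsto sub)
  hence lim: "(\<lambda>n. ereal (c * (?r n)\<^sup>2)) \<longlonglongrightarrow> ereal c" by simp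
  have "real (card (commuting_pairs G (ball n))) / (real (card (ball n)))\<^sup>2 \<le> c * (?r n)\<^sup>2" for n
  proof -
    have "(real m)\<^sup>2 * real (card (commuting_pairs G (ball n)))
      \<le> real (card P) * (real (card (ball (n + k))))\<^sup>2"
      using le[of n] by (simp flip: of_nat_mult of_nat_power)
    thus ?thesis
      using m card_ball_pos[of n] unfolding c by (simp add: field_simps)
  qed
  hence "dc G X \<le> limsup (\<lambda>n. ereal (c * (?r n)\<^sup>2))"
    unfolding dc_def by (intro Limsup_mono) (simp del: power_divide)
  also have "\<dots> = ereal c" using lim by (intro lim_imp_Limsup) auto
  finally show ?thesis by (simp add: c_def)
qed

text \<open>\<open>H\<close> is itself one of the \<open>m\<close> cosets, hence fills a share of
  the balls that stays away from zero, and all pairs from \<open>H\<close> commute.\<close>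

lemma dc_pos_of_abelian_subgroup:
  assumes sub: "subexponential_growth G X" and H: "subgroup H G" and fin: "finite_index G H"
    and comm: "\<And>x y. x \<in> H \<Longrightarrow> y \<in> H \<Longrightarrow> x \<otimes> y = y \<otimes> x"
  shows "dc G X > 0"
proof -
  define m where "m = card (rcosets H)"
  have m: "m > 0" unfolding m_def by (rule index_pos[OF fin])
  have HR: "H \<in> rcosets H" using H by (simp add: subgroup.subgroup_in_rcosets)
  obtain k where k: "\<And>n. card (ball n) \<le> m * card (H \<inter> ball (n + k))"
    using card_coset_ball_bounds[OF H fin] HR unfolding m_def by metis
  let ?f = "\<lambda>n. real (card (commuting_pairs G (ball n))) / (real (card (ball n)))\<^sup>2"
  \<comment> \<open>Since the ratio tends to 1, it is eventually below 2; squaring this 2 produces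
    the 4 in the lower bound.\<close>
  have "\<forall>\<^sub>F n in sequentially. real (card (ball (n + k))) / real (card (ball n)) < 2"
    using ball_ratio_tendsto[OF sub] by (rule order_tendstoD) simp
  hence "\<forall>\<^sub>F n in sequentially. 1 / (4 * (real m)\<^sup>2) \<le> ?f (n + k)"
  proof eventually_elim
    case (elim n)
    have "(H \<inter> ball (n + k)) \<times> (H \<inter> ball (n + k)) \<subseteq> commuting_pairs G (ball (n + k))"
      using comm by (auto simp: commuting_pairs_def)
    hence "(card (H \<inter> ball (n + k)))\<^sup>2 \<le> card (commuting_pairs G (ball (n + k)))"
      unfolding power2_eq_square card_cartesian_product[symmetric]
      by (intro card_mono finite_commuting_pairs finite_ball)
    hence C: "(real (card (H \<inter> ball (n + k))))\<^sup>2 \<le> real (card (commuting_pairs G (ball (n + k))))"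
      by (simp flip: of_nat_power)
    have "real (card (ball (n + k))) \<le> 2 * real (card (ball n))"
      using elim card_ball_pos[of n] by (simp add: field_simps)
    also have "\<dots> \<le> 2 * real (m * card (H \<inter> ball (n + k)))"
      using k[of n] by (simp only: of_nat_le_iff mult_le_cancel_left_pos zero_less_numeral)
    finally have "(real (card (ball (n + k))))\<^sup>2 \<le> (2 * real (m * card (H \<inter> ball (n + k))))\<^sup>2"
      by (intro power_mono) auto
    also have "\<dots> = 4 * (real m)\<^sup>2 * (real (card (H \<inter> ball (n + k))))\<^sup>2"
      by (simp add: power_mult_distrib)
    also have "\<dots> \<le> 4 * (real m)\<^sup>2 * real (card (commuting_pairs G (ball (n + k))))"
      using C by (intro mult_left_mono) auto
    finally show ?case using m card_ball_pos[of "n + k"] by (simp add: field_simps)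
  qed
  \<comment> \<open>The estimate was made at radius \<open>n + k\<close>, where \<open>k\<close>
    controls the part in \<open>H\<close>; shifting the index does not affect eventual
    truth.\<close>
  hence "\<forall>\<^sub>F n in sequentially. 1 / (4 * (real m)\<^sup>2) \<le> ?f n"
    by (subst (asm) eventually_sequentially_seg)
  hence "ereal (1 / (4 * (real m)\<^sup>2)) \<le> dc G X"
    unfolding dc_def by (intro le_Limsup) auto
  moreover have "0 < ereal (1 / (4 * (real m)\<^sup>2))" using m by simp
  ultimately show ?thesis by (rule less_le_trans[rotated])
qed

lemma dc_abelian:
  assumes "comm_group G"
  shows "dc G X = 1"
proof -
  interpret comm_group G by fact
  have "commuting_pairs G (ball n) = ball n \<times> ball n" for n
    using ball_subset[of n] by (auto simp: commuting_pairs_def subset_iff m_comm)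
  hence "real (card (commuting_pairs G (ball n))) / (real (card (ball n)))\<^sup>2 = 1" for n
    using card_ball_pos[of n] by (simp add: card_cartesian_product power2_eq_square)
  thus ?thesis
    unfolding dc_def by (simp only: Limsup_const[OF sequentially_bot] one_ereal_def)
qed

end

section \<open>Finite quotients\<close>

text \<open>Every coset of \<open>H \<inter> K\<close> is the intersection of a coset of
  \<open>H\<close> with one of \<open>K\<close>, and there are finitely many such
  intersections.\<close>

lemma (in group) finite_index_Int:
  assumes "subgroup H G" "subgroup K G" "finite_index G H" "finite_index G K"
  shows "finite_index G (H \<inter> K)"
  unfolding finite_index_def
proof (rule finite_subset)
  show "rcosets (H \<inter> K) \<subseteq> (\<lambda>(A, B). A \<inter> B) ` ((rcosets H) \<times> (rcosets K))"
  proof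
    fix S assume "S \<in> rcosets (H \<inter> K)"
    then obtain a where a: "a \<in> carrier G" "S = (H \<inter> K) #> a" unfolding RCOSETS_def by blast
    have "h = k" if "h \<in> H" "k \<in> K" "h \<otimes> a = k \<otimes> a" for h k
      using that a(1) subgroup.mem_carrier[OF assms(1)] subgroup.mem_carrier[OF assms(2)]
      by simp
    hence "S = (H #> a) \<inter> (K #> a)" unfolding a(2) r_coset_def by fast
    moreover have "H #> a \<in> rcosets H" "K #> a \<in> rcosets K"
      using a(1) unfolding RCOSETS_def by blast+
    ultimately show "S \<in> (\<lambda>(A, B). A \<inter> B) ` ((rcosets H) \<times> (rcosets K))"
      by (intro image_eqI[of _ _ "(H #> a, K #> a)"]) auto
  qed
  show "finite ((\<lambda>(A, B). A \<inter> B) ` ((rcosets H) \<times> (rcosets K)))"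
    using assms by (simp add: finite_index_def)
qed

text \<open>This is the natural projection between the quotients. It is well defined because the
  cosets of \<open>K\<close> refine those of \<open>N\<close>, and comes from the universal property
  of \<open>G Mod K\<close>.\<close>

lemma (in group) FactGroup_hom_of_subset:
  assumes N: "N \<lhd> G" and K: "K \<lhd> G" and "K \<subseteq> N"
  obtains h where "group_hom (G Mod K) (G Mod N) h"
    "h ` carrier (G Mod K) = carrier (G Mod N)"
    "\<And>x. x \<in> carrier G \<Longrightarrow> h (K #> x) = N #> x"
proof -
  interpret N: normal N G by fact
  interpret K: normal K G by fact
  have "N #> x = N #> y" if "x \<in> carrier G" "y \<in> carrier G" "K #> x = K #> y" for x y
  proof -
    have "y \<in> K #> x" using rcos_self[OF that(2) K.subgroup_axioms] that by simp
    hence "y \<in> N #> x" using \<open>K \<subseteq> N\<close> unfolding r_coset_def by blast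
    thus ?thesis using that N.subgroup_axioms by (intro repr_independence)
  qed
  then obtain h where h: "h \<in> hom (G Mod K) (G Mod N)"
      "\<And>x. x \<in> carrier G \<Longrightarrow> h (K #> x) = N #> x"
    using FactGroup_universal[OF N.r_coset_hom_Mod K] by metis
  have "group_hom (G Mod K) (G Mod N) h"
    using h(1) N.factorgroup_is_group K.factorgroup_is_group
    by (simp add: group_hom_def group_hom_axioms_def)
  moreover have "h ` carrier (G Mod K) = carrier (G Mod N)"
    using h(2) by (simp add: carrier_FactGroup image_image)
  ultimately show thesis using h(2) that by blast
qed

text \<open>By residual finiteness some commutator of elements of \<open>N\<close> survives in a finite quotient
  \<open>G / K\<close>, so \<open>N / K\<close> is a non-abelian finite group and Gallagher's inequality gains a factor \<open>5/8\<close>.\<close>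

lemma (in group) ex_normal_subgroup_commuting_probability_le:
  assumes rf: "residually_finite G" and N: "N \<lhd> G" and finN: "finite_index G N"
    and ab: "a \<in> N" "b \<in> N" "a \<otimes> b \<noteq> b \<otimes> a"
  obtains K where "K \<lhd> G" "finite_index G K"
    "commuting_probability (G Mod K) (carrier (G Mod K))
      \<le> commuting_probability (G Mod N) (carrier (G Mod N)) * (5 / 8)"
proof -
  interpret N: normal N G by fact
  have aG: "a \<in> carrier G" and bG: "b \<in> carrier G" using ab N.subset by auto
  \<comment> \<open>The commutator of \<open>a\<close> and \<open>b\<close>, written so that it lies
    in a subgroup exactly when \<open>a \<otimes> b\<close> and \<open>b \<otimes> a\<close> share a
    right coset.\<close>
  have "(a \<otimes> b) \<otimes> inv (b \<otimes> a) \<noteq> \<one>"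
    using ab(3) aG bG by (metis inv_equality inv_inv m_closed inv_closed)
  then obtain M where M: "M \<lhd> G" "finite_index G M" "(a \<otimes> b) \<otimes> inv (b \<otimes> a) \<notin> M"
    using rf aG bG unfolding residually_finite_def by (metis inv_closed m_closed)
  \<comment> \<open>Intersecting with \<open>N\<close> makes \<open>G Mod K\<close> project onto
    \<open>G Mod N\<close>, while \<open>K\<close> still avoids the commutator.\<close>
  define K where "K = N \<inter> M"
  have K: "K \<lhd> G" unfolding K_def using N M(1) by (rule normal_subgroup_intersect)
  have finK: "finite_index G K" unfolding K_def
    using N.subgroup_axioms normal_imp_subgroup[OF M(1)] finN M(2) by (rule finite_index_Int)
  interpret K: normal K G by (rule K)
  obtain h where hom: "group_hom (G Mod K) (G Mod N) h"
    and surj: "h ` carrier (G Mod K) = carrier (G Mod N)"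
    and h: "\<And>x. x \<in> carrier G \<Longrightarrow> h (K #> x) = N #> x"
    using FactGroup_hom_of_subset[OF N K] unfolding K_def by blast
  interpret h: group_hom "G Mod K" "G Mod N" h by (rule hom)
  let ?L = "kernel (G Mod K) (G Mod N) h"
  have fin: "finite (carrier (G Mod K))" using finK by (simp add: finite_index_def FactGroup_def)
  \<comment> \<open>Places the cosets of \<open>a\<close> and \<open>b\<close> in the kernel, which
    they then show to be non-abelian.\<close>
  have "K #> x \<in> ?L" if "x \<in> N" for x
    using that h[of x] coset_join2[OF _ N.subgroup_axioms that] N.subset
    by (auto simp: kernel_def FactGroup_def rcosetsI K.subset)
  moreover have "(K #> a) \<otimes>\<^bsub>G Mod K\<^esub> (K #> b) \<noteq> (K #> b) \<otimes>\<^bsub>G Mod K\<^esub> (K #> a)"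
  proof
    assume "(K #> a) \<otimes>\<^bsub>G Mod K\<^esub> (K #> b) = (K #> b) \<otimes>\<^bsub>G Mod K\<^esub> (K #> a)"
    hence "K #> (a \<otimes> b) = K #> (b \<otimes> a)" using aG bG by (simp add: K.rcos_sum)
    hence "a \<otimes> b \<in> K #> (b \<otimes> a)"
      using rcos_self[OF _ K.subgroup_axioms, of "a \<otimes> b"] aG bG by simp
    hence "(a \<otimes> b) \<otimes> inv (b \<otimes> a) \<in> K"
      using aG bG by (intro K.rcos_module_imp is_group) auto
    thus False using M(3) by (simp add: K_def)
  qed
  ultimately have "commuting_probability (G Mod K) ?L \<le> 5 / 8"
    using ab fin by (intro h.G.commuting_probability_nonabelian[of _ "K #> a" "K #> b"]
      h.subgroup_kernel) (auto simp: kernel_def)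
  hence "commuting_probability (G Mod N) (carrier (G Mod N)) * commuting_probability (G Mod K) ?L
    \<le> commuting_probability (G Mod N) (carrier (G Mod N)) * (5 / 8)"
    by (intro mult_left_mono commuting_probability_nonneg)
  with h.commuting_probability_le_kernel[OF fin surj] K finK show thesis
    using that by force
qed

lemma (in group) ex_noncommuting_of_not_virtually_abelian:
  assumes "\<not> virtually_abelian G" "subgroup H G" "finite_index G H"
  obtains a b where "a \<in> H" "b \<in> H" "a \<otimes> b \<noteq> b \<otimes> a"
proof -
  interpret H: group "G\<lparr>carrier := H\<rparr>" using assms(2) by (rule subgroup_imp_group)
  have "\<not> comm_group (G\<lparr>carrier := H\<rparr>)" using assms by (auto simp: virtually_abelian_def)
  thus thesis using H.group_comm_groupI that by force
qed

lemma (in group) finite_index_carrier: "finite_index G (carrier G)"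
proof -
  have "rcosets (carrier G) \<subseteq> {carrier G}"
    using coset_join2[OF _ subgroup_self] unfolding RCOSETS_def by blast
  thus ?thesis unfolding finite_index_def by (rule finite_subset) simp
qed

text \<open>The descent starts at the trivial quotient. It never stops, since a finite-index
  subgroup of a group that is not virtually abelian always contains a non-commuting pair.\<close>

lemma (in group) ex_quotient_commuting_probability_le_power:
  assumes "residually_finite G" "\<not> virtually_abelian G"
  shows "\<exists>N. N \<lhd> G \<and> finite_index G N \<and>
    commuting_probability (G Mod N) (carrier (G Mod N)) \<le> (5 / 8) ^ i"
proof (induction i)
  case 0
  have "carrier G \<lhd> G" by (rule normal_invI[OF subgroup_self]) simp
  moreover have "finite (carrier (G Mod carrier G))"
    using finite_index_carrier by (simp add: finite_index_def FactGroup_def)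
  ultimately show ?case
    using finite_index_carrier commuting_probability_le_1 by (intro exI[of _ "carrier G"]) simp
next
  case (Suc i)
  then obtain N where N: "N \<lhd> G" "finite_index G N"
    "commuting_probability (G Mod N) (carrier (G Mod N)) \<le> (5 / 8) ^ i" by blast
  obtain a b where "a \<in> N" "b \<in> N" "a \<otimes> b \<noteq> b \<otimes> a"
    using ex_noncommuting_of_not_virtually_abelian[OF assms(2) normal_imp_subgroup[OF N(1)] N(2)] .
  then obtain K where K: "K \<lhd> G" "finite_index G K"
    "commuting_probability (G Mod K) (carrier (G Mod K))
      \<le> commuting_probability (G Mod N) (carrier (G Mod N)) * (5 / 8)"
    using ex_normal_subgroup_commuting_probability_le[OF assms(1) N(1,2)] by metis
  thus ?case using N(3) by (intro exI[of _ K]) simp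
qed

section \<open>The two equivalences\<close>

context finitely_generated_group
begin

lemma virtually_abelian_of_dc_pos:
  assumes "residually_finite G" "subexponential_growth G X" "dc G X > 0"
  shows "virtually_abelian G"
proof (rule ccontr)
  assume "\<not> virtually_abelian G"
  hence "dc G X \<le> ereal ((5 / 8) ^ i)" for i
    using ex_quotient_commuting_probability_le_power[OF assms(1), of i]
      dc_le_commuting_probability[OF assms(2)] by (meson ereal_less_eq(3) order_trans)
  moreover have "(\<lambda>i. ereal ((5 / 8) ^ i)) \<longlonglongrightarrow> ereal 0"
    by (intro tendsto_ereal LIMSEQ_realpow_zero) auto
  ultimately have "dc G X \<le> 0"
    unfolding zero_ereal_def by (intro LIMSEQ_le_const) blast+
  thus False using assms(3) by simp
qed

lemma dc_pos_of_virtually_abelian: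
  assumes "subexponential_growth G X" "virtually_abelian G"
  shows "dc G X > 0"
proof -
  obtain H where H: "subgroup H G" "finite_index G H" "comm_group (G\<lparr>carrier := H\<rparr>)"
    using assms(2) unfolding virtually_abelian_def by blast
  interpret H: comm_group "G\<lparr>carrier := H\<rparr>" by (rule H(3))
  show ?thesis
    using H.m_comm by (intro dc_pos_of_abelian_subgroup[OF assms(1) H(1,2)]) simp
qed

text \<open>One descent step from the whole group is enough: any non-commuting pair yields a finite
  quotient with commuting probability at most \<open>5 / 8\<close>.\<close>

lemma comm_group_of_dc_gt:
  assumes "residually_finite G" "subexponential_growth G X" "dc G X > ereal (5 / 8)"
  shows "comm_group G"
proof (rule ccontr)
  assume "\<not> comm_group G"
  then obtain a b where "a \<in> carrier G" "b \<in> carrier G" "a \<otimes> b \<noteq> b \<otimes> a"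
    using group_comm_groupI by blast
  moreover have "carrier G \<lhd> G" by (rule normal_invI[OF subgroup_self]) simp
  ultimately obtain K where K: "K \<lhd> G" "finite_index G K"
    "commuting_probability (G Mod K) (carrier (G Mod K))
      \<le> commuting_probability (G Mod carrier G) (carrier (G Mod carrier G)) * (5 / 8)"
    using ex_normal_subgroup_commuting_probability_le[OF assms(1) _ finite_index_carrier] by metis
  moreover have "commuting_probability (G Mod carrier G) (carrier (G Mod carrier G)) \<le> 1"
    using finite_index_carrier
    by (intro commuting_probability_le_1) (simp add: finite_index_def FactGroup_def)
  ultimately have "ereal (commuting_probability (G Mod K) (carrier (G Mod K))) \<le> ereal (5 / 8)"
    by simp
  thus False
    using dc_le_commuting_probability[OF assms(2) K(1,2)] assms(3) by (meson leD order_trans)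
qed

end

theorem theorem1p5:
  fixes G :: "('a, 'b) monoid_scheme" and X :: "'a set"
  assumes "group G"
    and "finite X" and "generating_set G X"
    and "residually_finite G"
    and "subexponential_growth G X"
  shows "(dc G X > 0 \<longleftrightarrow> virtually_abelian G) \<and>
         (dc G X > ereal (5 / 8) \<longleftrightarrow> comm_group G)"
proof -
  interpret finitely_generated_group G X
    using assms by (simp add: finitely_generated_group_def finitely_generated_group_axioms_def)
  have "dc G X > ereal (5 / 8)" if "comm_group G"
    using dc_abelian[OF that] by (simp add: one_ereal_def)
  thus ?thesis
    using assms(4,5) virtually_abelian_of_dc_pos dc_pos_of_virtually_abelian comm_group_of_dc_gt
    by blast
qed

end
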